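(* Let $f\in\overline{co}\,\mathcal{U}$ be given by $f(z)=z+\sum_{n=2}^{\infty}a_nz^n$. Then for all integers $n,m\ge 2$, $$|a_na_m-a_{n+m-1}|\le\begin{cases} n+m-1, & \text{if } n=2,\ \text{or } m=2,\ \text{or } (n,m)\in\{(3,3),(3,4),(4,3)\},\\ (n-1)(m-1), & \text{otherwise.}\end{cases}$$ The second inequality is sharp, and equality holds for the Koebe function and its rotations, i.e., for the functions $z/(1-xz)^2$ with $|x|=1$.
   Context: $\mathbb{D}=\{z\in\mathbb{C}:|z|<1\}$ is the unit disk. $\mathcal{H}$ is the space of analytic functions on $\mathbb{D}$ with the topology of uniform convergence on compact subsets of $\mathbb{D}$. $\mathcal{A}$ is the class of $f\in\mathcal{H}$ with $f(0)=0$ and $f'(0)=1$. $\mathcal{U}$ is the class of functions $f\in\mathcal{A}$ satisfying $$\left|f'(z)\left(\frac{z}{f(z)}\right)^2-1\right|<1\quad\text{for all } z\in\mathbb{D};$$ here functions in $\mathcal{U}$ are non-vanishing in $\mathbb{D}\setminus\{0\}$, and $z/f(z)$ is understood to take the value $1$ at $z=0$. $\overline{co}\,\mathcal{U}$ denotes the closed convex hull of $\mathcal{U}$ in $\mathcal{H}$ (the smallest closed convex subset of $\mathcal{H}$ containing $\mathcal{U}$). The Koebe function is $k(z)=z/(1-z)^2$. *)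

theory Defs
  imports "HOL-Complex_Analysis.Complex_Analysis"
begin

abbreviation unit_disk :: "complex set" where
  "unit_disk \<equiv> ball 0 1"

text \<open>
  Functions on the disk are represented by total functions \<open>complex \<Rightarrow> complex\<close> whose values
  outside the disk are irrelevant: every set that is open or closed in the topology below, and
  each of the classes defined below, is invariant under changing functions outside the disk.
\<close>

definition hol_disk :: "(complex \<Rightarrow> complex) set" where
  "hol_disk = {f. f holomorphic_on unit_disk}"

definition compact_convergence_open :: "(complex \<Rightarrow> complex) set \<Rightarrow> bool" where
  "compact_convergence_open V \<longleftrightarrow> V \<subseteq> hol_disk \<and>
     (\<forall>f\<in>V. \<exists>K e. compact K \<and> K \<subseteq> unit_disk \<and> e > 0 \<and>
        {g \<in> hol_disk. \<forall>z\<in>K. dist (f z) (g z) < e} \<subseteq> V)"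

definition compact_convergence_topology :: "(complex \<Rightarrow> complex) topology" where
  "compact_convergence_topology = topology compact_convergence_open"

lemma compact_convergence_openE:
  assumes "compact_convergence_open V" "f \<in> V"
  obtains K e where "compact K" "K \<subseteq> unit_disk" "e > 0"
    "{g \<in> hol_disk. \<forall>z\<in>K. dist (f z) (g z) < e} \<subseteq> V"
proof -
  have "\<exists>K e. compact K \<and> K \<subseteq> unit_disk \<and> e > 0 \<and>
      {g \<in> hol_disk. \<forall>z\<in>K. dist (f z) (g z) < e} \<subseteq> V"
    using assms unfolding compact_convergence_open_def by simp
  then show thesis by (elim exE conjE) (rule that)
qed

lemma istopology_compact_convergence: "istopology compact_convergence_open"
  unfolding istopology_def
proof (intro conjI allI impI)
  fix S T
  assume S: "compact_convergence_open S" and T: "compact_convergence_open T"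
  show "compact_convergence_open (S \<inter> T)"
    unfolding compact_convergence_open_def
  proof (intro conjI ballI)
    show "S \<inter> T \<subseteq> hol_disk"
      using S by (auto simp: compact_convergence_open_def)
    fix f assume f: "f \<in> S \<inter> T"
    obtain K e where K: "compact K" "K \<subseteq> unit_disk" "e > 0"
      "{g \<in> hol_disk. \<forall>z\<in>K. dist (f z) (g z) < e} \<subseteq> S"
      using f by (auto elim: compact_convergence_openE[OF S])
    obtain L d where L: "compact L" "L \<subseteq> unit_disk" "d > 0"
      "{g \<in> hol_disk. \<forall>z\<in>L. dist (f z) (g z) < d} \<subseteq> T"
      using f by (auto elim: compact_convergence_openE[OF T])
    show "\<exists>K e. compact K \<and> K \<subseteq> unit_disk \<and> e > 0 \<and>
        {g \<in> hol_disk. \<forall>z\<in>K. dist (f z) (g z) < e} \<subseteq> S \<inter> T"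
    proof (intro exI conjI)
      show "compact (K \<union> L)" "K \<union> L \<subseteq> unit_disk" "min e d > 0"
        using K L by auto
      show "{g \<in> hol_disk. \<forall>z\<in>K \<union> L. dist (f z) (g z) < min e d} \<subseteq> S \<inter> T"
        using K(4) L(4) by auto
    qed
  qed
next
  fix \<K> assume \<K>: "\<forall>S\<in>\<K>. compact_convergence_open S"
  show "compact_convergence_open (\<Union> \<K>)"
    unfolding compact_convergence_open_def
  proof (intro conjI ballI)
    show "\<Union> \<K> \<subseteq> hol_disk"
      using \<K> by (auto simp: compact_convergence_open_def)
    fix f assume "f \<in> \<Union> \<K>"
    then obtain S where S: "S \<in> \<K>" "f \<in> S" by blast
    from \<K> S(1) have "compact_convergence_open S" by (rule bspec)
    then obtain K e where K: "compact K" "K \<subseteq> unit_disk" "e > 0"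
      "{g \<in> hol_disk. \<forall>z\<in>K. dist (f z) (g z) < e} \<subseteq> S"
      using S(2) by (rule compact_convergence_openE)
    show "\<exists>K e. compact K \<and> K \<subseteq> unit_disk \<and> e > 0 \<and>
        {g \<in> hol_disk. \<forall>z\<in>K. dist (f z) (g z) < e} \<subseteq> \<Union> \<K>"
      by (rule exI[of _ K], rule exI[of _ e],
          intro conjI K(1,2,3) order_trans[OF K(4)] Union_upper S(1))
  qed
qed

lemma openin_compact_convergence:
  "openin compact_convergence_topology V \<longleftrightarrow> compact_convergence_open V"
  unfolding compact_convergence_topology_def
  by (simp add: topology_inverse' istopology_compact_convergence)

lemma topspace_compact_convergence: "topspace compact_convergence_topology = hol_disk"
proof -
  have "compact_convergence_open hol_disk"
    unfolding compact_convergence_open_def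
    by (intro conjI ballI exI[of _ "{}"] exI[of _ "1::real"]) simp_all
  then show ?thesis
    unfolding topspace_def openin_compact_convergence
    by (intro equalityI Union_upper Union_least)
       (simp_all add: compact_convergence_open_def)
qed

lemma limitin_compact_convergence:
  "limitin compact_convergence_topology u f F \<longleftrightarrow>
     f \<in> hol_disk \<and> (\<forall>\<^sub>F n in F. u n \<in> hol_disk) \<and>
     (\<forall>K. compact K \<longrightarrow> K \<subseteq> unit_disk \<longrightarrow> uniform_limit K u f F)"
  (is "?L \<longleftrightarrow> ?R")
proof
  assume L: ?L
  then have f: "f \<in> hol_disk"
    by (simp add: limitin_def topspace_compact_convergence)
  have ev: "\<forall>\<^sub>F n in F. u n \<in> V" if "compact_convergence_open V" "f \<in> V" for V
    using L that by (simp add: limitin_def openin_compact_convergence)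
  have "\<forall>\<^sub>F n in F. u n \<in> hol_disk"
    using ev[of hol_disk] f topspace_compact_convergence
    by (metis openin_compact_convergence openin_topspace)
  moreover have "uniform_limit K u f F" if K: "compact K" "K \<subseteq> unit_disk" for K
    unfolding uniform_limit_iff
  proof (intro allI impI)
    fix e :: real assume e: "e > 0"
    define V where "V = {g \<in> hol_disk. \<exists>d<e. \<forall>z\<in>K. dist (f z) (g z) \<le> d}"
    have "compact_convergence_open V"
      unfolding compact_convergence_open_def
    proof (intro conjI ballI)
      show "V \<subseteq> hol_disk" by (auto simp: V_def)
      fix g assume "g \<in> V"
      then obtain d where d: "d < e" "\<forall>z\<in>K. dist (f z) (g z) \<le> d"
        by (auto simp: V_def)
      have "{h \<in> hol_disk. \<forall>z\<in>K. dist (g z) (h z) < (e - d) / 2} \<subseteq> V"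
      proof
        fix h assume h: "h \<in> {h \<in> hol_disk. \<forall>z\<in>K. dist (g z) (h z) < (e - d) / 2}"
        have "\<forall>z\<in>K. dist (f z) (h z) \<le> d + (e - d) / 2"
        proof
          fix z assume z: "z \<in> K"
          have "dist (f z) (h z) \<le> dist (f z) (g z) + dist (g z) (h z)"
            by (rule dist_triangle)
          moreover have "dist (f z) (g z) \<le> d" using z d(2) by blast
          moreover have "dist (g z) (h z) < (e - d) / 2" using z h by blast
          ultimately show "dist (f z) (h z) \<le> d + (e - d) / 2" by linarith
        qed
        moreover have "d + (e - d) / 2 < e"
          using d(1) by (simp add: field_simps)
        ultimately show "h \<in> V" using h by (auto simp: V_def)
      qed
      moreover have "(e - d) / 2 > 0" using d(1) by simp
      ultimately show "\<exists>K e. compact K \<and> K \<subseteq> unit_disk \<and> e > 0 \<and>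
          {h \<in> hol_disk. \<forall>z\<in>K. dist (g z) (h z) < e} \<subseteq> V"
        using K by (intro exI conjI)
    qed
    moreover have "f \<in> V" using f e by (auto simp: V_def intro!: exI[of _ 0])
    ultimately have "\<forall>\<^sub>F n in F. u n \<in> V" by (rule ev)
    moreover have "\<forall>z\<in>K. dist (g z) (f z) < e" if g: "g \<in> V" for g
    proof
      fix z assume z: "z \<in> K"
      obtain d where d: "d < e" "\<forall>z\<in>K. dist (f z) (g z) \<le> d"
        using g by (auto simp: V_def)
      have "dist (f z) (g z) \<le> d" using d(2) z by (rule bspec)
      with d(1) show "dist (g z) (f z) < e" by (subst dist_commute) linarith
    qed
    ultimately show "\<forall>\<^sub>F n in F. \<forall>z\<in>K. dist (u n z) (f z) < e"
      by (rule eventually_mono)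
  qed
  ultimately show ?R using f by blast
next
  assume R: ?R
  show ?L
    unfolding limitin_def topspace_compact_convergence openin_compact_convergence
  proof (intro conjI allI impI)
    show "f \<in> hol_disk" using R by blast
    fix V assume V: "compact_convergence_open V \<and> f \<in> V"
    obtain K e where K: "compact K" "K \<subseteq> unit_disk" "e > 0"
      "{g \<in> hol_disk. \<forall>z\<in>K. dist (f z) (g z) < e} \<subseteq> V"
      by (rule compact_convergence_openE[OF conjunct1[OF V] conjunct2[OF V]])
    have "\<forall>\<^sub>F n in F. \<forall>z\<in>K. dist (u n z) (f z) < e"
      using R K by (simp add: uniform_limit_iff)
    moreover have "\<forall>\<^sub>F n in F. u n \<in> hol_disk" using R by (elim conjE)
    ultimately show "\<forall>\<^sub>F n in F. u n \<in> V"
    proof eventually_elim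
      case (elim n)
      then have "u n \<in> {g \<in> hol_disk. \<forall>z\<in>K. dist (f z) (g z) < e}"
        by (simp add: dist_commute)
      with K(4) show ?case by (rule subsetD)
    qed
  qed
qed

text \<open>
  The function type is not an instance of class \<^class>\<open>real_vector\<close>, so convexity is spelled out
  with pointwise operations.
\<close>

definition convex_functions :: "(complex \<Rightarrow> complex) set \<Rightarrow> bool" where
  "convex_functions S \<longleftrightarrow>
     (\<forall>f\<in>S. \<forall>g\<in>S. \<forall>s\<ge>0. \<forall>t\<ge>0. s + t = 1 \<longrightarrow> (\<lambda>z. s *\<^sub>R f z + t *\<^sub>R g z) \<in> S)"

definition closed_convex_hull :: "(complex \<Rightarrow> complex) set \<Rightarrow> (complex \<Rightarrow> complex) set" where
  "closed_convex_hull A =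
     (\<lambda>S. closedin compact_convergence_topology S \<and> convex_functions S) hull A"

definition class_A :: "(complex \<Rightarrow> complex) set" where
  "class_A = {f \<in> hol_disk. f 0 = 0 \<and> deriv f 0 = 1}"

definition class_U :: "(complex \<Rightarrow> complex) set" where
  "class_U = {f \<in> class_A.
     (\<forall>z \<in> unit_disk - {0}. f z \<noteq> 0) \<and>
     (\<forall>z \<in> unit_disk. norm (deriv f z * (if z = 0 then 1 else z / f z)\<^sup>2 - 1) < 1)}"

text \<open>Rotations of the Koebe function, which itself is the case \<open>x = 1\<close>.\<close>

definition koebe_rotation :: "complex \<Rightarrow> complex \<Rightarrow> complex" where
  "koebe_rotation x z = z / (1 - x * z)\<^sup>2"

text \<open>
  The values \<open>a 0\<close> and \<open>a 1\<close> are unconstrained; the remaining ones are determined by \<open>f\<close>.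
\<close>

definition has_normalized_expansion :: "(complex \<Rightarrow> complex) \<Rightarrow> (nat \<Rightarrow> complex) \<Rightarrow> bool" where
  "has_normalized_expansion f a \<longleftrightarrow>
     (\<forall>z \<in> unit_disk. (\<lambda>k. a (k + 2) * z ^ (k + 2)) sums (f z - z))"

definition exceptional_pair :: "nat \<Rightarrow> nat \<Rightarrow> bool" where
  "exceptional_pair n m \<longleftrightarrow> n = 2 \<or> m = 2 \<or> (n, m) \<in> {(3, 3), (3, 4), (4, 3)}"

end

theory Submission
  imports Defs
begin

text \<open>
  Write \<open>c k = a (k + 1) / (k + 1)\<close> with \<open>a 1 = 1\<close>. For \<open>z / (1 - x z)\<^sup>2\<close> this is \<open>x ^ k\<close>, and the
  whole proof rests on the fact that, for every function in the closed convex hull, \<open>c\<close> behaves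
  like the moment sequence of a probability measure on the circle.

  For \<open>f\<close> in the class itself, let \<open>f z = z * (h z)\<^sup>2\<close> and \<open>h = 1 / (1 - w)\<close>. If \<open>w\<close> reached modulus
  one, then at a first such point \<open>z0\<close> Jack's lemma gives \<open>z0 * w' z0 = k * w z0\<close> with a real
  \<open>k \<ge> 1\<close>, and there the expression that defines the class becomes
  \<open>w * (2 k - 2 - (2 k - 1) * w)\<close>, of modulus at least \<open>(2 k - 1) - (2 k - 2) = 1\<close>. So \<open>w\<close> maps
  the disk into itself, and therefore \<open>h\<close> has real part at least \<open>1 / 2\<close>
  (\<open>class_U_subordination\<close>).

  A function with real part at least \<open>1 / 2\<close> and value one at the origin is an average of the kernels
  \<open>1 / (1 - x z)\<close> with \<open>x\<close> on the circle. Hence \<open>h\<^sup>2\<close> is an average of products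
  \<open>1 / ((1 - x z) * (1 - y z))\<close>, and each of these is the mean of \<open>1 / (1 - \<zeta> z)\<^sup>2\<close> over the
  chord from \<open>y\<close> to \<open>x\<close>. Instead of a representing measure, the proof carries the linear
  inequalities that it would imply: \<open>Re (\<Sum> b k * c k) \<ge> 0\<close> whenever the polynomial with coefficients
  \<open>b\<close> has nonnegative real part on the closed disk (\<open>moment_positive\<close>). Each of them cuts out a
  closed half space, so they pass from the class to its closed convex hull.

  Finally let \<open>p = n - 1\<close> and \<open>q = m - 1\<close>. The inequalities for a suitable polynomial in
  \<open>\<zeta> ^ p\<close>, \<open>\<zeta> ^ q\<close>, \<open>\<zeta> ^ (p + q)\<close> imply that the covariance \<open>c (p + q) - c p * c q\<close> has modulus at
  most \<open>1 - t\<close>, where \<open>t = norm (c p) * norm (c q)\<close> (\<open>moment_covariance_bound\<close>). Since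
  \<open>(p + 1) * (q + 1) = p * q + (p + q + 1)\<close>, the quantity to be estimated is at most
  \<open>p * q * t + (p + q + 1) * (1 - t)\<close>, hence at most the larger of \<open>p * q\<close> and \<open>p + q + 1\<close>; the
  exceptional pairs are exactly those with \<open>p * q \<le> p + q + 1\<close>. A rotation of the Koebe function has
  \<open>c k = x ^ k\<close>, so the covariance vanishes, \<open>t = 1\<close>, and the value \<open>p * q\<close> is attained.
\<close>


section \<open>Jack's lemma\<close>

text \<open>
  The curve \<open>t \<mapsto> z0 * exp (t * c)\<close> is radial for \<open>c = 1\<close> and runs along the circle through \<open>z0\<close> for
  \<open>c = \<i>\<close>, so one formula serves for both derivatives in Jack's lemma.
\<close>

lemma norm_square_along_exp_has_derivative:
  fixes w :: "complex \<Rightarrow> complex"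
  assumes "(w has_field_derivative d) (at z0)"
  shows "((\<lambda>t. (norm (w (z0 * exp (of_real t * c))))\<^sup>2) has_real_derivative
            2 * Re (cnj (w z0) * (d * z0 * c))) (at 0)"
proof -
  have "((\<lambda>\<zeta>. w (z0 * exp (\<zeta> * c))) has_field_derivative d * (z0 * c)) (at (of_real 0))"
    by (rule DERIV_chain2[where g = "\<lambda>\<zeta>. z0 * exp (\<zeta> * c)"])
       (auto intro!: derivative_eq_intros assms)
  from has_vector_derivative_real_field[OF this]
  have v: "((\<lambda>t. w (z0 * exp (of_real t * c))) has_vector_derivative d * (z0 * c)) (at 0)"
    by (simp add: o_def)
  have "((\<lambda>t. Re (cnj (w (z0 * exp (of_real t * c))) * w (z0 * exp (of_real t * c))))
          has_real_derivative
          Re (cnj (w z0) * (d * (z0 * c)) + cnj (d * (z0 * c)) * w z0)) (at 0)"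
    using has_field_derivative_Re[OF has_vector_derivative_mult[OF has_vector_derivative_cnj[OF v] v]]
    by simp
  moreover have "Re (cnj u * u) = (norm u)\<^sup>2" for u
    by (metis Re_complex_of_real complex_norm_square mult.commute)
  ultimately show ?thesis
    by (simp add: algebra_simps)
qed

text \<open>
  The point \<open>z0\<close> is one of least modulus among those where \<open>norm (w z) \<ge> 1\<close>. Radial limits then
  bound \<open>w\<close> by one on the whole circle through \<open>z0\<close>.
\<close>

lemma boundary_modulus_point:
  assumes hol: "w holomorphic_on ball 0 1" and w0: "w 0 = 0"
    and z1: "norm z1 < 1" "norm (w z1) \<ge> 1"
  obtains z0 :: complex where "z0 \<noteq> 0" "norm z0 < 1" "norm (w z0) = 1"
    "\<And>z. norm z < norm z0 \<Longrightarrow> norm (w z) < 1"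
    "\<And>z. norm z = norm z0 \<Longrightarrow> norm (w z) \<le> 1"
proof -
  have cont: "continuous_on (ball 0 1) w"
    using hol by (rule holomorphic_on_imp_continuous_on)
  define K where "K = {z \<in> cball 0 (norm z1). norm (w z) \<ge> 1}"
  have cK: "continuous_on (cball 0 (norm z1)) w"
    by (rule continuous_on_subset[OF cont]) (use z1 in auto)
  have "closed K"
    unfolding K_def by (intro continuous_on_closed_Collect_le cK continuous_intros) auto
  then have "compact K"
    unfolding K_def by (metis (no_types, lifting) K_def bounded_cball bounded_subset compact_eq_bounded_closed mem_Collect_eq subsetI)
  moreover have "K \<noteq> {}" using z1 by (auto simp: K_def)
  ultimately obtain z0 where z0: "z0 \<in> K" "\<And>z. z \<in> K \<Longrightarrow> norm z0 \<le> norm z"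
    using continuous_attains_inf[of K norm] by (auto intro: continuous_intros)
  have n0: "norm z0 < 1" "norm (w z0) \<ge> 1" "norm z0 \<le> norm z1" using z0(1) z1 by (auto simp: K_def)
  have less: "norm (w z) < 1" if "norm z < norm z0" for z
    using z0(2)[of z] that n0 by (force simp: K_def)
  have le: "norm (w z) \<le> 1" if z: "norm z = norm z0" for z
  proof -
    have "z \<in> ball 0 1" using z n0 by simp
    then have "isCont w z" using cont continuous_on_interior by fastforce
    then have "((\<lambda>t. norm (w (of_real t * z))) \<longlongrightarrow> norm (w z)) (at_left (1::real))"
      by (intro tendsto_norm isCont_tendsto_compose[of _ w] tendsto_eq_intros) auto
    moreover have "\<forall>\<^sub>F t in at_left (1::real). norm (w (of_real t * z)) \<le> 1"
    proof -
      have "norm (w (of_real t * z)) \<le> 1" if "t > 0" "t < 1" for t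
      proof -
        have "z0 \<noteq> 0" using n0 w0 by auto
        then show ?thesis using that z by (intro less_imp_le less) (simp add: norm_mult)
      qed
      then show ?thesis
        using eventually_at_left_real[of 0 "1::real"] by (auto elim!: eventually_mono)
    qed
    ultimately show ?thesis by (intro tendsto_upperbound) auto
  qed
  show thesis
    using n0 le[of z0] w0 less le by (intro that[of z0]) (auto intro: antisym)
qed

text \<open>
  At a first point where \<open>w\<close> attains modulus one, \<open>norm (w z)\<close> is maximal along the circle, which makes
  \<open>z0 * w' z0 / w z0\<close> real. By the Schwarz lemma \<open>norm (w (z0 * \<zeta>)) \<le> norm \<zeta>\<close>, with
  equality at \<open>\<zeta> = 1\<close>; comparing radial derivatives there shows that the quotient is at least one.
\<close>

lemma Jack:
  assumes hol: "w holomorphic_on ball 0 1" and w0: "w 0 = 0"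
    and z1: "norm z1 < 1" "norm (w z1) \<ge> 1"
  obtains z0 :: complex and k :: real
  where "norm z0 < 1" "norm (w z0) = 1" "k \<ge> 1" "z0 * deriv w z0 = of_real k * w z0"
proof -
  obtain z0 where z0: "z0 \<noteq> 0" "norm z0 < 1" "norm (w z0) = 1"
    and less: "\<And>z. norm z < norm z0 \<Longrightarrow> norm (w z) < 1"
    and le: "\<And>z. norm z = norm z0 \<Longrightarrow> norm (w z) \<le> 1"
    using boundary_modulus_point[OF assms] by metis
  have der: "(w has_field_derivative deriv w z0) (at z0)"
    using hol z0 by (intro holomorphic_derivI) auto
  (* As w z0 is unimodular, L is the quotient z0 * w' z0 / w z0. *)
  define L where "L = cnj (w z0) * (deriv w z0 * z0)"
  have schwarz: "norm (w (z0 * \<zeta>)) \<le> norm \<zeta>" if "norm \<zeta> < 1" for \<zeta>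
  proof -
    have "z0 * \<xi> \<in> ball 0 1" if "norm \<xi> < 1" for \<xi>
      using z0 that mult_strict_mono[of "norm z0" 1 "norm \<xi>" 1] by (simp add: norm_mult)
    then have "(\<lambda>\<xi>. w (z0 * \<xi>)) holomorphic_on ball 0 1"
      by (intro holomorphic_on_compose_gen[OF _ hol, unfolded o_def] holomorphic_intros) auto
    moreover have "norm (w (z0 * \<xi>)) < 1" if "norm \<xi> < 1" for \<xi>
      using that z0 by (intro less) (simp add: norm_mult)
    ultimately show ?thesis
      using Schwarz_Lemma(1)[of "\<lambda>\<xi>. w (z0 * \<xi>)" \<zeta>] that w0 by simp
  qed
  have d: "((\<lambda>t. (norm (w (z0 * exp (of_real t * c))))\<^sup>2) has_real_derivative 2 * Re (L * c)) (at 0)" for c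
    using norm_square_along_exp_has_derivative[OF der, of c] by (simp add: L_def mult_ac)
  have "Im L = 0"
  proof -
    have "2 * Re (L * \<i>) = 0"
    proof (rule DERIV_local_max[OF d, of 1])
      have "norm (w (z0 * exp (of_real t * \<i>))) \<le> 1" for t
        by (rule le) (simp add: norm_mult)
      then show "\<forall>y. \<bar>0 - y\<bar> < 1 \<longrightarrow> (norm (w (z0 * exp (of_real y * \<i>))))\<^sup>2
          \<le> (norm (w (z0 * exp (of_real 0 * \<i>))))\<^sup>2"
        using z0 by (simp add: power_le_one)
    qed simp
    then show ?thesis by simp
  qed
  moreover have "Re L \<ge> 1"
  proof (rule ccontr)
    assume "\<not> Re L \<ge> 1"
    define u where "u t = (norm (w (z0 * exp (of_real t))))\<^sup>2 - exp (2 * t)" for t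
    have "(u has_real_derivative 2 * Re L - 2) (at 0)"
      unfolding u_def by (rule derivative_eq_intros d[of 1, simplified] refl | simp)+
    moreover have "2 * Re L - 2 < 0" using \<open>\<not> Re L \<ge> 1\<close> by simp
    ultimately obtain e where e: "e > 0" "\<And>h. 0 < h \<Longrightarrow> h < e \<Longrightarrow> u 0 < u (0 - h)"
      using DERIV_neg_dec_left by blast
    have "u 0 = 0" using z0 by (simp add: u_def)
    moreover have "u (- (e/2)) \<le> 0"
    proof -
      have "norm (w (z0 * exp (of_real (-(e/2))))) \<le> norm (exp (of_real (-(e/2))) :: complex)"
        using e by (intro schwarz) (simp only: norm_exp_eq_Re, simp)
      then have "norm (w (z0 * exp (of_real (-(e/2))))) \<le> exp (-(e/2))"
        by (simp only: norm_exp_eq_Re) simp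
      then have "(norm (w (z0 * exp (of_real (-(e/2))))))\<^sup>2 \<le> (exp (-(e/2)))\<^sup>2"
        by (rule power_mono) simp
      then show ?thesis by (simp add: u_def flip: exp_double)
    qed
    ultimately show False using e(2)[of "e/2"] e(1) by simp
  qed
  moreover have "z0 * deriv w z0 = L * w z0"
  proof -
    have "cnj (w z0) * w z0 = 1"
      using complex_norm_square[of "w z0"] z0 by (simp add: mult.commute)
    then show ?thesis by (simp add: L_def mult_ac)
  qed
  ultimately show thesis
    using z0 by (intro that[of z0 "Re L"]) (auto simp: complex_eq_iff)
qed

section \<open>Subordination for the class U\<close>

text \<open>
  Away from the origin \<open>f\<close> has no zeros, and its zero there is simple, so \<open>f z / z\<close> extends to a zero-free
  function on the disk, which has a square root. Multiplying a root \<open>s\<close> by \<open>s 0 = \<plusminus>1\<close> gives the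
  branch with value one at the origin.
\<close>

lemma class_U_holomorphic_sqrt:
  assumes "f \<in> class_U"
  obtains h where "h holomorphic_on unit_disk" "h 0 = 1"
    "\<And>z. z \<in> unit_disk \<Longrightarrow> h z \<noteq> 0" "\<And>z. z \<in> unit_disk \<Longrightarrow> f z = z * (h z)\<^sup>2"
proof -
  have holf: "f holomorphic_on unit_disk" and f0: "f 0 = 0" "deriv f 0 = 1"
    and nz: "\<And>z. z \<in> unit_disk \<Longrightarrow> z \<noteq> 0 \<Longrightarrow> f z \<noteq> 0"
    using assms by (auto simp: class_U_def class_A_def hol_disk_def)
  define q where "q z = (if z = 0 then deriv f 0 else (f z - f 0) / (z - 0))" for z
  have "q holomorphic_on unit_disk"
    unfolding q_def by (rule pole_lemma[OF holf]) simp
  moreover have q_nz: "q z \<noteq> 0" if "z \<in> unit_disk" for z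
    using nz[OF that] f0 by (auto simp: q_def)
  moreover have "simply_connected unit_disk"
    by (simp add: convex_imp_simply_connected)
  ultimately obtain s where s: "s holomorphic_on unit_disk" "\<And>z. z \<in> unit_disk \<Longrightarrow> q z = (s z)\<^sup>2"
    using simply_connected_eq_holomorphic_sqrt[OF open_ball, of 0 1] by blast
  have s0: "(s 0)\<^sup>2 = 1"
    using s(2)[of 0] f0 by (simp add: q_def)
  have sq: "(s 0 * s z)\<^sup>2 = q z" if "z \<in> unit_disk" for z
    using s(2)[OF that] s0 by (simp add: power_mult_distrib)
  show thesis
  proof (rule that[of "\<lambda>z. s 0 * s z"])
    show "(\<lambda>z. s 0 * s z) holomorphic_on unit_disk"
      using s(1) by (intro holomorphic_intros)
    show "s 0 * s 0 = 1"
      using s0 by (simp add: power2_eq_square)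
    show "s 0 * s z \<noteq> 0" if "z \<in> unit_disk" for z
      using q_nz[OF that] sq[OF that] by auto
    show "f z = z * (s 0 * s z)\<^sup>2" if "z \<in> unit_disk" for z
      using sq[OF that] f0 by (simp add: q_def)
  qed
qed

text \<open>
  The quotient on the left is \<open>f' z0 * (z0 / f z0)\<^sup>2\<close> for \<open>f z = z * (h z)\<^sup>2\<close>, where \<open>H\<close> and \<open>D\<close> stand for
  \<open>h z0\<close> and \<open>h' z0\<close>. The first hypothesis is the conclusion \<open>z0 * w' z0 = k * W\<close> of Jack's lemma for
  \<open>w = 1 - 1 / h\<close>.
\<close>

lemma class_U_functional_of_sqrt:
  fixes H D z0 :: complex and k :: real
  assumes "z0 * D = of_real k * W * H\<^sup>2" "W = 1 - inverse H" "H \<noteq> 0"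
  shows "(H\<^sup>2 + 2 * z0 * H * D) / H ^ 4 - 1 = W * (of_real (2 * k - 2) - of_real (2 * k - 1) * W)"
proof -
  have "2 * z0 * H * D = 2 * of_real k * W * H ^ 3"
    using assms(1) by (simp add: power2_eq_square power3_eq_cube mult_ac)
  then have "(H\<^sup>2 + 2 * z0 * H * D) / H ^ 4 = (inverse H)\<^sup>2 + 2 * of_real k * W * inverse H"
    using assms(3) by (simp add: field_simps power2_eq_square power3_eq_cube power4_eq_xxxx)
  also have "inverse H = 1 - W" using assms(2) by simp
  finally show ?thesis by (simp add: power2_eq_square algebra_simps)
qed

text \<open>
  In other words, \<open>f z / z\<close> is subordinate to \<open>1 / (1 - z)\<^sup>2\<close>: the condition \<open>Re (h z) \<ge> 1 / 2\<close> says
  that \<open>w = 1 - 1 / h\<close> maps the disk into the closed disk.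
\<close>

lemma class_U_subordination:
  assumes "f \<in> class_U"
  obtains h where "h holomorphic_on unit_disk" "h 0 = 1"
    "\<And>z. z \<in> unit_disk \<Longrightarrow> Re (h z) \<ge> 1 / 2"
    "\<And>z. z \<in> unit_disk \<Longrightarrow> f z = z * (h z)\<^sup>2"
proof -
  obtain h where h: "h holomorphic_on unit_disk" "h 0 = 1"
      "\<And>z. z \<in> unit_disk \<Longrightarrow> h z \<noteq> 0" "\<And>z. z \<in> unit_disk \<Longrightarrow> f z = z * (h z)\<^sup>2"
    using class_U_holomorphic_sqrt[OF assms] by metis
  define w where "w z = 1 - inverse (h z)" for z
  have hol_w: "w holomorphic_on unit_disk"
    unfolding w_def using h by (intro holomorphic_intros) auto
  have w0: "w 0 = 0"
    using h(2) by (simp add: w_def)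
  have small: "norm (w z1) < 1" if z1: "norm z1 < 1" for z1
  proof (rule ccontr)
    assume "\<not> norm (w z1) < 1"
    then obtain z0 and k :: real where z0: "norm z0 < 1" "norm (w z0) = 1" "k \<ge> 1"
        "z0 * deriv w z0 = of_real k * w z0"
      using Jack[OF hol_w w0 z1] by (metis not_less)
    have mem: "z0 \<in> unit_disk" using z0 by simp
    define H D where "H = h z0" and "D = deriv h z0"
    have H: "H \<noteq> 0" using h(3)[OF mem] by (simp add: H_def)
    have "z0 \<noteq> 0" using z0 w0 by auto
    have dh: "(h has_field_derivative D) (at z0)"
      unfolding D_def by (rule holomorphic_derivI[OF h(1) open_ball mem])
    have "(w has_field_derivative D / H\<^sup>2) (at z0)"
      unfolding w_def[abs_def] using H
      by (auto intro!: derivative_eq_intros dh simp: H_def power2_eq_square field_simps)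
    then have "deriv w z0 = D / H\<^sup>2" by (rule DERIV_imp_deriv)
    then have "z0 * D = z0 * deriv w z0 * H\<^sup>2"
      using H by simp
    then have zD: "z0 * D = of_real k * w z0 * H\<^sup>2"
      by (simp only: z0(4))
    have "((\<lambda>z. z * (h z)\<^sup>2) has_field_derivative H\<^sup>2 + 2 * z0 * H * D) (at z0)"
      by (auto intro!: derivative_eq_intros dh simp: H_def algebra_simps)
    then have "(f has_field_derivative H\<^sup>2 + 2 * z0 * H * D) (at z0)"
      by (rule has_field_derivative_transform_within_open[OF _ open_ball mem]) (use h(4) in auto)
    then have df: "deriv f z0 = H\<^sup>2 + 2 * z0 * H * D" by (rule DERIV_imp_deriv)
    have "norm (deriv f z0 * (z0 / f z0)\<^sup>2 - 1) < 1"
      using assms mem \<open>z0 \<noteq> 0\<close> by (force simp: class_U_def)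
    moreover have "z0 / f z0 = inverse (H\<^sup>2)"
      using h(4)[OF mem] \<open>z0 \<noteq> 0\<close> by (simp add: H_def field_simps)
    then have "deriv f z0 * (z0 / f z0)\<^sup>2 = (H\<^sup>2 + 2 * z0 * H * D) / H ^ 4"
      by (simp add: df field_simps flip: power_mult)
    ultimately have "norm ((H\<^sup>2 + 2 * z0 * H * D) / H ^ 4 - 1) < 1" by simp
    also have "(H\<^sup>2 + 2 * z0 * H * D) / H ^ 4 - 1
        = w z0 * (of_real (2 * k - 2) - of_real (2 * k - 1) * w z0)"
      using zD _ H by (rule class_U_functional_of_sqrt) (simp add: w_def H_def)
    finally have "norm (of_real (2 * k - 2) - of_real (2 * k - 1) * w z0) < 1"
      using z0(2) by (simp add: norm_mult)
    moreover have "norm (of_real (2 * k - 1) * w z0) - norm (of_real (2 * k - 2) :: complex)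
        \<le> norm (of_real (2 * k - 1) * w z0 - of_real (2 * k - 2))"
      by (rule norm_triangle_ineq2)
    then have "(2 * k - 1) - (2 * k - 2) \<le> norm (of_real (2 * k - 2) - of_real (2 * k - 1) * w z0)"
      using z0 unfolding norm_mult norm_of_real by (simp add: norm_minus_commute)
    ultimately show False by simp
  qed
  have "Re (h z) \<ge> 1 / 2" if z: "z \<in> unit_disk" for z
  proof -
    have "h z * w z = h z - 1" using h(3)[OF z] by (simp add: w_def field_simps)
    then have "norm (h z - 1) = norm (h z) * norm (w z)" by (metis norm_mult)
    also have "\<dots> \<le> norm (h z)"
      using small[of z] z by (intro mult_left_le) auto
    finally have "(norm (h z - 1))\<^sup>2 \<le> (norm (h z))\<^sup>2" by (rule power_mono) simp
    then show ?thesis unfolding cmod_power2 by (simp add: power2_eq_square algebra_simps)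
  qed
  with h show thesis using that by metis
qed

section \<open>Positive moment sequences\<close>

lemma coefficient_contour_integral:
  assumes "h holomorphic_on unit_disk" "h has_fps_expansion H" "0 < r" "r < 1"
  shows "((\<lambda>z. h z / z ^ Suc k) has_contour_integral 2 * pi * \<i> * fps_nth H k) (circlepath 0 r)"
proof -
  have "((\<lambda>u. h u / (u - 0) ^ Suc k) has_contour_integral
        2 * pi * \<i> / fact k * (deriv ^^ k) h 0) (circlepath 0 r)"
  proof (rule Cauchy_has_contour_integral_higher_derivative_circlepath)
    show "continuous_on (cball 0 r) h"
      using assms by (intro holomorphic_on_imp_continuous_on holomorphic_on_subset[OF assms(1)]) auto
    show "h holomorphic_on ball 0 r"
      using assms by (intro holomorphic_on_subset[OF assms(1)]) auto
  qed (use assms in auto)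
  then show ?thesis
    by (simp add: fps_nth_fps_expansion[OF assms(2)])
qed

text \<open>
  The number \<open>c\<close> is the mean value of \<open>F\<close> over the circle.
\<close>

lemma Re_circle_mean_nonneg:
  assumes int: "((\<lambda>z. F z / z) has_contour_integral 2 * pi * \<i> * c) (circlepath 0 r)"
    and "r > 0" and F: "\<And>z. norm z = r \<Longrightarrow> Re (F z) \<ge> 0"
  shows "Re c \<ge> 0"
proof -
  have "((\<lambda>t. F (circlepath 0 r t) / circlepath 0 r t * (2 * pi * \<i> * r * exp (2 * of_real pi * \<i> * t)))
      has_integral 2 * pi * \<i> * c) {0..1}"
    using int unfolding has_contour_integral vector_derivative_circlepath .
  then have "((\<lambda>t. 2 * pi * \<i> * F (circlepath 0 r t)) has_integral 2 * pi * \<i> * c) {0..1}"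
    using \<open>r > 0\<close> by (simp add: circlepath mult_ac)
  from has_integral_mult_right[OF this, of "inverse (2 * pi * \<i>)"]
  have "((\<lambda>t. F (circlepath 0 r t)) has_integral c) {0..1}"
    by (simp add: field_simps)
  from has_integral_linear[OF this bounded_linear_Re]
  have "((\<lambda>t. Re (F (circlepath 0 r t))) has_integral Re c) {0..1}"
    by (simp add: o_def)
  then show ?thesis
  proof (rule has_integral_nonneg)
    fix t :: real
    have "norm (circlepath 0 r t) = r"
      using \<open>r > 0\<close> by (simp add: circlepath norm_mult)
    then show "0 \<le> Re (F (circlepath 0 r t))" by (rule F)
  qed
qed

text \<open>
  By the Herglotz theorem these are the moment sequences of the positive measures on the circle. The
  form chosen here, a family of linear inequalities in \<open>c\<close>, is the one that is visibly inherited by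
  limits and convex combinations. Positivity of the test polynomials is required on the whole disk
  because the averages over chords below evaluate them at interior points.
\<close>

definition moment_positive :: "(nat \<Rightarrow> complex) \<Rightarrow> bool" where
  "moment_positive c \<longleftrightarrow> (\<forall>n b. (\<forall>\<zeta>\<in>cball 0 1. Re (\<Sum>k\<le>n. b k * \<zeta> ^ k) \<ge> 0) \<longrightarrow>
     Re (\<Sum>k\<le>n. b k * c k) \<ge> 0)"

lemma moment_positiveD:
  assumes "moment_positive c" "\<And>\<zeta>. norm \<zeta> \<le> 1 \<Longrightarrow> Re (\<Sum>k\<le>n. b k * \<zeta> ^ k) \<ge> 0"
  shows "Re (\<Sum>k\<le>n. b k * c k) \<ge> 0"
  using assms by (auto simp: moment_positive_def)

text \<open>
  For \<open>norm z = r\<close> and \<open>x = r / z\<close>, let \<open>B x = (\<Sum>k\<le>n. b k * x ^ k)\<close>. The mean over the circle of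
  the nonnegative function \<open>(2 * Re (h z) - 1) * Re (B x)\<close> is the real part in question. To integrate it by
  Cauchy's formula, it is written as the real part of \<open>(h z - 1) * B x + h z * cnj (B x)\<close>, where
  \<open>cnj (B x)\<close> agrees on the circle with a polynomial in \<open>z\<close> because \<open>cnj x = z / r\<close>.
\<close>

lemma Re_half_plane_dilated_moment_nonneg:
  assumes hol: "h holomorphic_on unit_disk" and exp: "h has_fps_expansion H" and h0: "h 0 = 1"
    and half: "\<And>z. z \<in> unit_disk \<Longrightarrow> Re (h z) \<ge> 1 / 2"
    and b: "\<And>\<zeta>. norm \<zeta> \<le> 1 \<Longrightarrow> Re (\<Sum>k\<le>n. b k * \<zeta> ^ k) \<ge> 0"
    and r: "0 < r" "r < 1"
  shows "Re (\<Sum>k\<le>n. b k * of_real r ^ k * fps_nth H k) \<ge> 0"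
proof -
  define P where "P z = (\<Sum>k\<le>n. cnj (b k) * (z / of_real r) ^ k)" for z
  define F where "F z = (h z - 1) * (\<Sum>k\<le>n. b k * (of_real r / z) ^ k) + h z * P z" for z
  define S where "S = (\<Sum>k\<le>n. b k * of_real r ^ k * fps_nth (H - 1) k)"
  have 1: "((\<lambda>z. \<Sum>k\<le>n. b k * of_real r ^ k * ((h z - 1) / z ^ Suc k))
      has_contour_integral (\<Sum>k\<le>n. b k * of_real r ^ k * (2 * pi * \<i> * fps_nth (H - 1) k)))
      (circlepath 0 r)"
    using hol exp r
    by (intro has_contour_integral_sum has_contour_integral_lmul coefficient_contour_integral
              holomorphic_intros fps_expansion_intros) auto
  have P_hol: "(\<lambda>z. h z * P z) holomorphic_on unit_disk"
    unfolding P_def using hol r by (intro holomorphic_intros) auto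
  have exp_P: "(\<lambda>z. h z * P z) has_fps_expansion fps_expansion (\<lambda>z. h z * P z) 0"
    by (rule has_fps_expansion_fps_expansion[OF open_ball _ P_hol]) simp
  have "P 0 = cnj (b 0)"
    unfolding P_def by (simp add: power_0_left if_distrib sum.delta cong: if_cong)
  then have 2: "((\<lambda>z. h z * P z / z) has_contour_integral 2 * pi * \<i> * cnj (b 0)) (circlepath 0 r)"
    using coefficient_contour_integral[OF P_hol exp_P r, of 0] h0
    by (simp add: fps_expansion_def)
  have "((\<lambda>z. F z / z) has_contour_integral 2 * pi * \<i> * (S + cnj (b 0))) (circlepath 0 r)"
  proof (rule has_contour_integral_eq)
    show "((\<lambda>z. (\<Sum>k\<le>n. b k * of_real r ^ k * ((h z - 1) / z ^ Suc k)) + h z * P z / z)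
        has_contour_integral 2 * pi * \<i> * (S + cnj (b 0))) (circlepath 0 r)"
      using has_contour_integral_add[OF 1 2]
      by (simp add: S_def sum_distrib_left distrib_left mult_ac)
    show "(\<Sum>k\<le>n. b k * of_real r ^ k * ((h z - 1) / z ^ Suc k)) + h z * P z / z = F z / z" for z
      by (simp add: F_def sum_distrib_left sum_divide_distrib add_divide_distrib power_divide mult_ac)
  qed
  moreover have "Re (F z) \<ge> 0" if z: "norm z = r" for z
  proof -
    define x where "x = of_real r / z"
    have "z \<noteq> 0" using z r by auto
    have x: "norm x = 1" using z r by (simp add: x_def norm_divide)
    have "x * cnj x = 1" using x complex_norm_square[of x] by simp
    then have "z / of_real r = cnj x"
      using r \<open>z \<noteq> 0\<close> by (simp add: x_def field_simps)
    then have P: "P z = cnj (\<Sum>k\<le>n. b k * x ^ k)" by (simp add: P_def)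
    have "Re (F z) = (2 * Re (h z) - 1) * Re (\<Sum>k\<le>n. b k * x ^ k)"
      unfolding F_def P x_def[symmetric] by (simp add: algebra_simps del: Re_sum Im_sum cnj_sum)
    also have "\<dots> \<ge> 0"
      using half[of z] b[of x] x z r by (intro mult_nonneg_nonneg) auto
    finally show ?thesis .
  qed
  ultimately have "Re (S + cnj (b 0)) \<ge> 0"
    using Re_circle_mean_nonneg r by blast
  moreover have "S = (\<Sum>k\<le>n. b k * of_real r ^ k * fps_nth H k) - b 0"
  proof -
    have "S = (\<Sum>k\<le>n. b k * of_real r ^ k * fps_nth H k - (if k = 0 then b 0 else 0))"
      unfolding S_def by (intro sum.cong) (auto simp: algebra_simps)
    then show ?thesis by (simp add: sum_subtractf)
  qed
  ultimately show ?thesis by simp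
qed

lemma Re_half_plane_imp_moment_positive:
  assumes "h holomorphic_on unit_disk" "h has_fps_expansion H" "h 0 = 1"
    and "\<And>z. z \<in> unit_disk \<Longrightarrow> Re (h z) \<ge> 1 / 2"
  shows "moment_positive (fps_nth H)"
  unfolding moment_positive_def
proof (intro allI impI)
  fix n and b :: "nat \<Rightarrow> complex"
  assume b: "\<forall>\<zeta>\<in>cball 0 1. Re (\<Sum>k\<le>n. b k * \<zeta> ^ k) \<ge> 0"
  have "((\<lambda>r. Re (\<Sum>k\<le>n. b k * of_real r ^ k * fps_nth H k)) \<longlongrightarrow>
      Re (\<Sum>k\<le>n. b k * of_real 1 ^ k * fps_nth H k)) (at_left (1::real))"
    by (intro tendsto_intros)
  moreover have "\<forall>\<^sub>F r in at_left (1::real). Re (\<Sum>k\<le>n. b k * of_real r ^ k * fps_nth H k) \<ge> 0"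
    using eventually_at_left_real[OF zero_less_one]
    by eventually_elim (use Re_half_plane_dilated_moment_nonneg[OF assms] b in auto)
  ultimately have "Re (\<Sum>k\<le>n. b k * of_real 1 ^ k * fps_nth H k) \<ge> 0"
    by (intro tendsto_lowerbound) auto
  then show "Re (\<Sum>k\<le>n. b k * fps_nth H k) \<ge> 0" by simp
qed

text \<open>
  If \<open>G\<close> is an antiderivative of the test polynomial, the sum is \<open>(G x - G y) / (x - y)\<close>, that is,
  the mean value of the polynomial over the chord from \<open>y\<close> to \<open>x\<close>, which lies in the disk.
\<close>

lemma chord_average_nonneg:
  fixes x y :: complex
  assumes b: "\<And>\<zeta>. norm \<zeta> \<le> 1 \<Longrightarrow> Re (\<Sum>k\<le>n. b k * \<zeta> ^ k) \<ge> 0"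
    and xy: "norm x \<le> 1" "norm y \<le> 1"
  shows "Re (\<Sum>k\<le>n. b k * ((\<Sum>i\<le>k. x ^ i * y ^ (k - i)) / of_nat (Suc k))) \<ge> 0"
proof (cases "x = y")
  case True
  have "(\<Sum>i\<le>k. x ^ i * y ^ (k - i)) / of_nat (Suc k) = x ^ k" for k
    using True by (simp add: power_add[symmetric] field_simps del: of_nat_Suc)
  then show ?thesis using b[of x] xy by simp
next
  case False
  define G where "G \<zeta> = (\<Sum>k\<le>n. b k * (\<zeta> ^ Suc k / of_nat (Suc k)))" for \<zeta> :: complex
  define \<phi> where "\<phi> t = Re (G (y + of_real t * (x - y)) / (x - y))" for t
  have G: "(G has_field_derivative (\<Sum>k\<le>n. b k * \<zeta> ^ k)) (at \<zeta>)" for \<zeta>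
    unfolding G_def[abs_def]
  proof (intro DERIV_sum)
    fix k
    show "((\<lambda>\<zeta>. b k * (\<zeta> ^ Suc k / of_nat (Suc k))) has_field_derivative b k * \<zeta> ^ k) (at \<zeta>)"
      using DERIV_cmult[OF DERIV_cdivide[OF DERIV_power_Suc[OF DERIV_ident, of k],
              of "of_nat (Suc k)"], of "b k"]
      unfolding of_nat_Suc[symmetric] by (simp del: of_nat_Suc power_Suc)
  qed
  have "\<phi> 0 \<le> \<phi> 1"
  proof (rule DERIV_nonneg_imp_nondecreasing[of 0 1 \<phi>])
    fix t :: real assume t: "0 \<le> t" "t \<le> 1"
    let ?\<zeta> = "y + of_real t * (x - y)"
    have "((\<lambda>u. G (y + u * (x - y)) / (x - y)) has_field_derivative (\<Sum>k\<le>n. b k * ?\<zeta> ^ k))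
        (at (of_real t))"
      using False by (auto intro!: derivative_eq_intros DERIV_chain2[OF G])
    from has_field_derivative_Re[OF has_vector_derivative_real_field[OF this]]
    have "(\<phi> has_real_derivative Re (\<Sum>k\<le>n. b k * ?\<zeta> ^ k)) (at t)"
      by (simp add: \<phi>_def[abs_def] o_def)
    moreover have "?\<zeta> = (1 - t) *\<^sub>R y + t *\<^sub>R x"
      by (simp add: scaleR_conv_of_real algebra_simps)
    then have "?\<zeta> \<in> cball 0 1"
      using convexD[OF convex_cball, of y 0 1 x "1 - t" t] xy t by simp
    ultimately show "\<exists>d. (\<phi> has_real_derivative d) (at t) \<and> d \<ge> 0"
      using b[of ?\<zeta>] by auto
  qed simp
  moreover have "G x - G y = (x - y) * (\<Sum>k\<le>n. b k * ((\<Sum>i\<le>k. x ^ i * y ^ (k - i)) / of_nat (Suc k)))"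
  proof -
    have "G x - G y = (\<Sum>k\<le>n. b k * ((x ^ Suc k - y ^ Suc k) / of_nat (Suc k)))"
      by (simp only: G_def sum_subtractf right_diff_distrib diff_divide_distrib)
    also have "\<dots> = (\<Sum>k\<le>n. (x - y) * (b k * ((\<Sum>i\<le>k. x ^ i * y ^ (k - i)) / of_nat (Suc k))))"
      by (intro sum.cong refl)
         (simp only: diff_power_eq_sum lessThan_Suc_atMost times_divide_eq_right mult.left_commute)
    also have "\<dots> = (x - y) * (\<Sum>k\<le>n. b k * ((\<Sum>i\<le>k. x ^ i * y ^ (k - i)) / of_nat (Suc k)))"
      by (rule sum_distrib_left[symmetric])
    finally show ?thesis .
  qed
  then have "(\<Sum>k\<le>n. b k * ((\<Sum>i\<le>k. x ^ i * y ^ (k - i)) / of_nat (Suc k)))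
      = G x / (x - y) - G y / (x - y)"
    using False by (simp only: diff_divide_distrib[symmetric]) simp
  ultimately show ?thesis
    by (simp only: \<phi>_def minus_complex.sel) simp
qed

text \<open>
  For a representing measure \<open>\<mu>\<close>, the new sequence is the average of the chord means
  \<open>(\<Sum>i\<le>k. x ^ i * y ^ (k - i)) / (k + 1)\<close> with respect to \<open>\<mu>\<close> in both \<open>x\<close> and \<open>y\<close>. Accordingly, the
  hypothesis is applied twice, first to the polynomial in \<open>x\<close> for each fixed \<open>y\<close>, then to the one in \<open>y\<close>.
\<close>

lemma moment_positive_average_square:
  assumes c: "moment_positive c"
  shows "moment_positive (\<lambda>k. (\<Sum>i\<le>k. c i * c (k - i)) / of_nat (Suc k))"
  unfolding moment_positive_def
proof (intro allI impI)
  fix n and b :: "nat \<Rightarrow> complex"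
  assume b: "\<forall>\<zeta>\<in>cball 0 1. Re (\<Sum>k\<le>n. b k * \<zeta> ^ k) \<ge> 0"
  (* The array m turns the sum over triangles into one over squares, in which x and y separate. *)
  define m where "m i j = (if i + j \<le> n then b (i + j) / of_nat (Suc (i + j)) else 0)" for i j
  have bilinear: "(\<Sum>k\<le>n. b k * ((\<Sum>i\<le>k. u i * v (k - i)) / of_nat (Suc k)))
      = (\<Sum>i\<le>n. \<Sum>j\<le>n. m i j * u i * v j)" for u v
  proof -
    have "(\<Sum>i\<le>n. \<Sum>j\<le>n. m i j * u i * v j) = (\<Sum>(i, j)\<in>{..n} \<times> {..n}. m i j * u i * v j)"
      by (simp add: sum.cartesian_product)
    also have "\<dots> = (\<Sum>(i, j) | i + j \<le> n. m i j * u i * v j)"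
      by (rule sum.mono_neutral_right) (auto simp: m_def split: if_splits)
    also have "\<dots> = (\<Sum>k\<le>n. \<Sum>i\<le>k. m i (k - i) * u i * v (k - i))"
      by (rule sum.triangle_reindex_eq)
    also have "\<dots> = (\<Sum>k\<le>n. b k * ((\<Sum>i\<le>k. u i * v (k - i)) / of_nat (Suc k)))"
      by (intro sum.cong refl) (simp add: m_def sum_distrib_left sum_divide_distrib mult_ac)
    finally show ?thesis ..
  qed
  have one: "Re (\<Sum>j\<le>n. (\<Sum>i\<le>n. m i j * c i) * y ^ j) \<ge> 0" if y: "norm y \<le> 1" for y
  proof -
    have "Re (\<Sum>i\<le>n. (\<Sum>j\<le>n. m i j * y ^ j) * c i) \<ge> 0"
    proof (rule moment_positiveD[OF c])
      fix x :: complex assume x: "norm x \<le> 1"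
      have "Re (\<Sum>k\<le>n. b k * ((\<Sum>i\<le>k. x ^ i * y ^ (k - i)) / of_nat (Suc k))) \<ge> 0"
        by (rule chord_average_nonneg[OF _ x y]) (use b in \<open>simp del: Re_sum\<close>)
      also have "(\<Sum>k\<le>n. b k * ((\<Sum>i\<le>k. x ^ i * y ^ (k - i)) / of_nat (Suc k)))
          = (\<Sum>i\<le>n. \<Sum>j\<le>n. m i j * x ^ i * y ^ j)"
        by (rule bilinear)
      also have "\<dots> = (\<Sum>i\<le>n. (\<Sum>j\<le>n. m i j * y ^ j) * x ^ i)"
        by (simp add: sum_distrib_left sum_distrib_right mult_ac)
      finally show "Re (\<Sum>i\<le>n. (\<Sum>j\<le>n. m i j * y ^ j) * x ^ i) \<ge> 0" .
    qed
    also have "(\<Sum>i\<le>n. (\<Sum>j\<le>n. m i j * y ^ j) * c i) = (\<Sum>j\<le>n. (\<Sum>i\<le>n. m i j * c i) * y ^ j)"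
      unfolding sum_distrib_right by (subst sum.swap) (simp add: mult_ac)
    finally show ?thesis .
  qed
  have "Re (\<Sum>j\<le>n. (\<Sum>i\<le>n. m i j * c i) * c j) \<ge> 0"
    by (rule moment_positiveD[OF c one])
  also have "(\<Sum>j\<le>n. (\<Sum>i\<le>n. m i j * c i) * c j) = (\<Sum>i\<le>n. \<Sum>j\<le>n. m i j * c i * c j)"
    unfolding sum_distrib_right by (rule sum.swap)
  finally show "Re (\<Sum>k\<le>n. b k * ((\<Sum>i\<le>k. c i * c (k - i)) / of_nat (Suc k))) \<ge> 0"
    unfolding bilinear .
qed

section \<open>Coefficient half spaces and the closed convex hull\<close>

definition taylor_coeff :: "(complex \<Rightarrow> complex) \<Rightarrow> nat \<Rightarrow> complex" where
  "taylor_coeff f k = (deriv ^^ k) f 0 / fact k"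

lemma taylor_coeff_eq_fps_nth: "f has_fps_expansion F \<Longrightarrow> taylor_coeff f k = fps_nth F k"
  by (simp add: taylor_coeff_def fps_nth_fps_expansion)

lemma hol_disk_has_fps_expansion:
  assumes "f \<in> hol_disk"
  shows "f has_fps_expansion Abs_fps (taylor_coeff f)"
proof -
  have "f has_fps_expansion fps_expansion f 0"
    using assms by (intro has_fps_expansion_fps_expansion[of unit_disk]) (auto simp: hol_disk_def)
  also have "fps_expansion f 0 = Abs_fps (taylor_coeff f)"
    by (simp add: fps_expansion_def taylor_coeff_def fps_eq_iff)
  finally show ?thesis .
qed

lemma taylor_coeff_linear:
  assumes "f \<in> hol_disk" "g \<in> hol_disk"
  shows "taylor_coeff (\<lambda>z. s *\<^sub>R f z + t *\<^sub>R g z) k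
       = of_real s * taylor_coeff f k + of_real t * taylor_coeff g k"
proof -
  have "(\<lambda>z. s *\<^sub>R f z + t *\<^sub>R g z) has_fps_expansion
      fps_const (of_real s) * Abs_fps (taylor_coeff f) + fps_const (of_real t) * Abs_fps (taylor_coeff g)"
    using assms by (intro fps_expansion_intros hol_disk_has_fps_expansion)
  from taylor_coeff_eq_fps_nth[OF this] show ?thesis by simp
qed

text \<open>
  Cauchy's inequality on the circle of radius \<open>1 / 2\<close>: Taylor coefficients are continuous in the topology of
  compact convergence.
\<close>

lemma taylor_coeff_diff_le:
  assumes fg: "f \<in> hol_disk" "g \<in> hol_disk"
    and close: "\<And>z. z \<in> cball 0 (1/2) \<Longrightarrow> dist (f z) (g z) \<le> e"
  shows "norm (taylor_coeff f k - taylor_coeff g k) \<le> e * 2 ^ k"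
proof -
  have hol: "f holomorphic_on unit_disk" "g holomorphic_on unit_disk"
    using fg by (auto simp: hol_disk_def)
  have "norm ((deriv ^^ k) (\<lambda>z. f z - g z) 0) \<le> fact k * e / (1/2) ^ k"
  proof (rule Cauchy_inequality)
    show "(\<lambda>z. f z - g z) holomorphic_on ball 0 (1/2)"
      by (intro holomorphic_intros hol[THEN holomorphic_on_subset]) auto
    show "continuous_on (cball 0 (1/2)) (\<lambda>z. f z - g z)"
      by (intro holomorphic_on_imp_continuous_on holomorphic_intros hol[THEN holomorphic_on_subset]) auto
    show "norm (f z - g z) \<le> e" if "norm (0 - z) = 1/2" for z
      using close[of z] that by (simp add: dist_norm)
  qed simp
  also have "(deriv ^^ k) (\<lambda>z. f z - g z) 0 = (deriv ^^ k) f 0 - (deriv ^^ k) g 0"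
    using hol by (intro higher_deriv_diff[of f unit_disk]) auto
  finally have "norm ((deriv ^^ k) f 0 - (deriv ^^ k) g 0) / fact k \<le> e * 2 ^ k"
    by (simp add: field_simps)
  then show ?thesis
    by (simp add: taylor_coeff_def norm_divide flip: diff_divide_distrib)
qed

text \<open>
  If the functional \<open>L\<close> has negative real part at \<open>f\<close>, it still does at every function uniformly close
  to \<open>f\<close> on the disk of radius \<open>1 / 2\<close>.
\<close>

lemma closedin_coefficient_half_space:
  "closedin compact_convergence_topology {f \<in> hol_disk. Re (\<Sum>k\<in>I. b k * taylor_coeff f k) \<ge> 0}"
proof -
  define L where "L f = (\<Sum>k\<in>I. b k * taylor_coeff f k)" for f
  define M where "M = (\<Sum>k\<in>I. norm (b k) * 2 ^ k)"
  have M: "M \<ge> 0" unfolding M_def by (intro sum_nonneg) auto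
  have "compact_convergence_open (hol_disk - {f \<in> hol_disk. Re (L f) \<ge> 0})"
    unfolding compact_convergence_open_def
  proof (intro conjI ballI)
    fix f assume f: "f \<in> hol_disk - {f \<in> hol_disk. Re (L f) \<ge> 0}"
    (* M bounds the norm of L with respect to the uniform distance on the disk of radius 1/2; M + 1 avoids dividing by zero. *)
    define e where "e = - Re (L f) / (M + 1)"
    have e: "e > 0" using f M by (auto simp: e_def intro!: divide_neg_pos)
    have "{g \<in> hol_disk. \<forall>z\<in>cball 0 (1/2). dist (f z) (g z) < e}
        \<subseteq> hol_disk - {f \<in> hol_disk. Re (L f) \<ge> 0}"
    proof
      fix g assume g: "g \<in> {g \<in> hol_disk. \<forall>z\<in>cball 0 (1/2). dist (f z) (g z) < e}"
      have "norm (L g - L f) \<le> (\<Sum>k\<in>I. norm (b k) * (e * 2 ^ k))"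
        unfolding L_def sum_subtractf[symmetric] right_diff_distrib[symmetric]
      proof (rule sum_norm_le)
        fix k
        have "norm (taylor_coeff g k - taylor_coeff f k) \<le> e * 2 ^ k"
          using f g by (intro taylor_coeff_diff_le) (auto simp: dist_commute less_imp_le)
        then show "norm (b k * (taylor_coeff g k - taylor_coeff f k)) \<le> norm (b k) * (e * 2 ^ k)"
          unfolding norm_mult by (rule mult_left_mono) simp
      qed
      also have "\<dots> = M * e" by (simp add: M_def sum_distrib_left mult_ac)
      also have "\<dots> < (M + 1) * e" using e by simp
      also have "\<dots> = - Re (L f)" using M by (simp add: e_def)
      finally have "Re (L g - L f) < - Re (L f)" using complex_Re_le_cmod le_less_trans by blast
      then show "g \<in> hol_disk - {f \<in> hol_disk. Re (L f) \<ge> 0}" using g by simp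
    qed
    moreover have "cball 0 (1/2) \<subseteq> unit_disk" by auto
    ultimately show "\<exists>K e. compact K \<and> K \<subseteq> unit_disk \<and> e > 0 \<and>
        {g \<in> hol_disk. \<forall>z\<in>K. dist (f z) (g z) < e} \<subseteq> hol_disk - {f \<in> hol_disk. Re (L f) \<ge> 0}"
      using e compact_cball by blast
  qed auto
  then show ?thesis
    by (auto simp: closedin_def topspace_compact_convergence openin_compact_convergence L_def)
qed

lemma convex_coefficient_half_space:
  "convex_functions {f \<in> hol_disk. Re (\<Sum>k\<in>I. b k * taylor_coeff f k) \<ge> 0}"
  unfolding convex_functions_def
proof (intro ballI allI impI)
  fix f g and s t :: real
  assume f: "f \<in> {f \<in> hol_disk. Re (\<Sum>k\<in>I. b k * taylor_coeff f k) \<ge> 0}"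
    and g: "g \<in> {f \<in> hol_disk. Re (\<Sum>k\<in>I. b k * taylor_coeff f k) \<ge> 0}"
    and st: "s \<ge> 0" "t \<ge> 0" "s + t = 1"
  have "(\<Sum>k\<in>I. b k * taylor_coeff (\<lambda>z. s *\<^sub>R f z + t *\<^sub>R g z) k)
      = of_real s * (\<Sum>k\<in>I. b k * taylor_coeff f k) + of_real t * (\<Sum>k\<in>I. b k * taylor_coeff g k)"
    using f g by (simp add: taylor_coeff_linear sum_distrib_left sum.distrib algebra_simps)
  then have "Re (\<Sum>k\<in>I. b k * taylor_coeff (\<lambda>z. s *\<^sub>R f z + t *\<^sub>R g z) k) \<ge> 0"
    using f g st by (simp del: Re_sum)
  moreover have "(\<lambda>z. s *\<^sub>R f z + t *\<^sub>R g z) \<in> hol_disk"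
    using f g by (auto simp: hol_disk_def scaleR_conv_of_real intro!: holomorphic_intros)
  ultimately show "(\<lambda>z. s *\<^sub>R f z + t *\<^sub>R g z)
      \<in> {f \<in> hol_disk. Re (\<Sum>k\<in>I. b k * taylor_coeff f k) \<ge> 0}"
    by simp
qed

text \<open>
  As \<open>f z = z * (h z)\<^sup>2\<close>, the coefficient of index \<open>k + 1\<close> of \<open>f\<close> is that of index \<open>k\<close> of \<open>h\<^sup>2\<close>, a
  Cauchy product.
\<close>

lemma class_U_moment_positive:
  assumes "f \<in> class_U"
  shows "moment_positive (\<lambda>k. taylor_coeff f (Suc k) / of_nat (Suc k))"
proof -
  obtain h where h: "h holomorphic_on unit_disk" "h 0 = 1"
      "\<And>z. z \<in> unit_disk \<Longrightarrow> Re (h z) \<ge> 1 / 2" "\<And>z. z \<in> unit_disk \<Longrightarrow> f z = z * (h z)\<^sup>2"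
    using class_U_subordination[OF assms] by metis
  define H where "H = fps_expansion h 0"
  have H: "h has_fps_expansion H"
    unfolding H_def by (rule has_fps_expansion_fps_expansion[OF open_ball _ h(1)]) simp
  have "\<forall>\<^sub>F z in nhds 0. z * (h z * h z) = f z"
    using eventually_nhds_in_open[of unit_disk 0]
    by (auto elim!: eventually_mono simp: h(4) power2_eq_square)
  moreover have "(\<lambda>z. z * (h z * h z)) has_fps_expansion fps_X * (H * H)"
    by (intro fps_expansion_intros H)
  ultimately have "f has_fps_expansion fps_X * (H * H)"
    by (rule iffD1[OF has_fps_expansion_cong[OF _ refl]])
  then have "taylor_coeff f (Suc k) = (\<Sum>i\<le>k. fps_nth H i * fps_nth H (k - i))" for k
    by (simp add: taylor_coeff_eq_fps_nth fps_mult_nth[of H H] atMost_atLeast0)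
  then show ?thesis
    using moment_positive_average_square[OF Re_half_plane_imp_moment_positive[OF h(1) H h(2,3)]]
    by simp
qed

lemma closed_convex_hull_class_U_moment_positive:
  assumes "f \<in> closed_convex_hull class_U"
  shows "f \<in> hol_disk" "moment_positive (\<lambda>k. taylor_coeff f (Suc k) / of_nat (Suc k))"
proof -
  have sum_eq: "(\<Sum>k\<le>n. b k * (taylor_coeff g (Suc k) / of_nat (Suc k)))
      = (\<Sum>k\<in>Suc ` {..n}. b (k - 1) / of_nat k * taylor_coeff g k)" for n b g
    by (simp add: sum.reindex del: image_Suc_atMost)
  have in_half_space: "f \<in> {f \<in> hol_disk. Re (\<Sum>k\<le>n. b k * (taylor_coeff f (Suc k) / of_nat (Suc k))) \<ge> 0}"
    if b: "\<And>\<zeta>. norm \<zeta> \<le> 1 \<Longrightarrow> Re (\<Sum>k\<le>n. b k * \<zeta> ^ k) \<ge> 0" for n b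
  proof -
    let ?S = "{f \<in> hol_disk. Re (\<Sum>k\<le>n. b k * (taylor_coeff f (Suc k) / of_nat (Suc k))) \<ge> 0}"
    have "class_U \<subseteq> ?S"
      using moment_positiveD[OF class_U_moment_positive b]
      by (auto simp: class_U_def class_A_def simp del: Re_sum of_nat_Suc)
    moreover have "closedin compact_convergence_topology ?S \<and> convex_functions ?S"
      unfolding sum_eq by (intro conjI closedin_coefficient_half_space convex_coefficient_half_space)
    ultimately have "closed_convex_hull class_U \<subseteq> ?S"
      unfolding closed_convex_hull_def by (rule hull_minimal)
    with assms show ?thesis by blast
  qed
  from in_half_space[where n = 0 and b = "\<lambda>_. 0"] show "f \<in> hol_disk" by simp
  show "moment_positive (\<lambda>k. taylor_coeff f (Suc k) / of_nat (Suc k))"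
    unfolding moment_positive_def using in_half_space by (simp del: Re_sum of_nat_Suc)
qed

lemma has_normalized_expansion_taylor_coeff:
  assumes "has_normalized_expansion f a"
  shows "taylor_coeff f (Suc k) = (if k = 0 then 1 else a (Suc k))"
proof -
  define F where "F = Abs_fps (\<lambda>n. if n = 0 then 0 else if n = 1 then 1 else a n)"
  have "f has_fps_expansion F"
  proof (rule has_fps_expansionI)
    have "(\<lambda>n. fps_nth F n * z ^ n) sums f z" if "z \<in> unit_disk" for z
    proof -
      have "(\<lambda>k. fps_nth F (k + 2) * z ^ (k + 2)) sums (f z - z)"
        using assms that by (simp add: has_normalized_expansion_def F_def)
      then show ?thesis
        by (subst (asm) sums_iff_shift) (simp add: F_def eval_nat_numeral)
    qed
    then show "\<forall>\<^sub>F z in nhds 0. (\<lambda>n. fps_nth F n * z ^ n) sums f z"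
      using eventually_nhds_in_open[of unit_disk 0] by (auto elim!: eventually_mono)
  qed
  then show ?thesis by (simp add: taylor_coeff_eq_fps_nth F_def)
qed

section \<open>The covariance bound and the coefficient inequality\<close>

text \<open>
  For moments of a measure, the left-hand side is the integral of
  \<open>(norm (s + \<tau> * x ^ p + cnj (x ^ q)))\<^sup>2\<close>. Inside the disk the same expression exceeds the square
  by \<open>(1 - norm (\<zeta> ^ p) ^ 2) + (1 - norm (\<zeta> ^ q) ^ 2) \<ge> 0\<close>.
\<close>

lemma moment_quadratic_form_nonneg:
  assumes c: "moment_positive c" and "c 0 = 1" and \<tau>: "norm \<tau> = 1"
  shows "(norm s)\<^sup>2 + 2 + 2 * Re (cnj s * \<tau> * c p + s * c q + \<tau> * c (p + q)) \<ge> 0"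
proof -
  (* Separate summands, since p = q and vanishing indices can make the four positions coincide. *)
  define b where "b k = (if k = 0 then of_real ((norm s)\<^sup>2 + 2) else 0)
      + (if k = p then 2 * cnj s * \<tau> else 0) + (if k = q then 2 * s else 0)
      + (if k = p + q then 2 * \<tau> else 0)" for k
  have b: "(\<Sum>k\<le>p + q. b k * u k) = of_real ((norm s)\<^sup>2 + 2) * u 0
      + 2 * (cnj s * \<tau> * u p + s * u q + \<tau> * u (p + q))" for u
  proof -
    have "(\<Sum>k\<le>p + q. b k * u k) = (\<Sum>k\<le>p + q. (if k = 0 then of_real ((norm s)\<^sup>2 + 2) * u k else 0)
      + (if k = p then 2 * cnj s * \<tau> * u k else 0) + (if k = q then 2 * s * u k else 0)
      + (if k = p + q then 2 * \<tau> * u k else 0))"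
      by (intro sum.cong refl) (simp add: b_def algebra_simps)
    then show ?thesis by (simp add: sum.distrib distrib_left mult.assoc)
  qed
  have "Re (\<Sum>k\<le>p + q. b k * c k) \<ge> 0"
  proof (rule moment_positiveD[OF c])
    fix \<zeta> :: complex assume \<zeta>: "norm \<zeta> \<le> 1"
    define A B where "A = \<zeta> ^ p" and "B = \<zeta> ^ q"
    have le: "norm A \<le> 1" "norm B \<le> 1"
      using \<zeta> by (simp_all add: A_def B_def norm_power power_le_one)
    have "(norm (s + \<tau> * A + cnj B))\<^sup>2
        = (norm s)\<^sup>2 + (norm (\<tau> * A))\<^sup>2 + (norm B)\<^sup>2 + 2 * Re (cnj s * \<tau> * A + s * B + \<tau> * (A * B))"
      unfolding cmod_power2 by (simp add: power2_eq_square algebra_simps)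
    also have "(norm (\<tau> * A))\<^sup>2 = (norm A)\<^sup>2" using \<tau> by (simp add: norm_mult)
    finally have "(norm s)\<^sup>2 + 2 + 2 * Re (cnj s * \<tau> * A + s * B + \<tau> * (A * B))
        = (norm (s + \<tau> * A + cnj B))\<^sup>2 + (1 - (norm A)\<^sup>2) + (1 - (norm B)\<^sup>2)"
      by simp
    also have "\<dots> \<ge> 0" using le by (intro add_nonneg_nonneg) (auto simp: power_le_one)
    also have "(norm s)\<^sup>2 + 2 + 2 * Re (cnj s * \<tau> * A + s * B + \<tau> * (A * B))
        = Re (\<Sum>k\<le>p + q. b k * \<zeta> ^ k)"
      unfolding b by (simp add: A_def B_def power_add)
    finally show "Re (\<Sum>k\<le>p + q. b k * \<zeta> ^ k) \<ge> 0" .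
  qed
  then show ?thesis unfolding b by (simp add: \<open>c 0 = 1\<close>)
qed

text \<open>
  The choice of \<open>s\<close> completes the square in the quadratic form and leaves
  \<open>2 - (norm (c p))\<^sup>2 - (norm (c q))\<^sup>2 + 2 * Re (\<tau> * d) \<ge> 0\<close> with the covariance \<open>d\<close>; the choice of \<open>\<tau>\<close> turns
  \<open>Re (\<tau> * d)\<close> into \<open>- norm d\<close>.
\<close>

lemma moment_covariance_bound:
  assumes c: "moment_positive c" "c 0 = 1"
  shows "norm (c (p + q) - c p * c q) \<le> 1 - norm (c p) * norm (c q)"
proof -
  define d where "d = c (p + q) - c p * c q"
  define \<tau> where "\<tau> = (if d = 0 then 1 else - cnj d / norm d)"
  define s where "s = - (\<tau> * c p + cnj (c q))"
  have \<tau>: "norm \<tau> = 1" by (auto simp: \<tau>_def norm_divide)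
  have "\<tau> * d = - of_real (norm d)"
    using complex_norm_square[of d] by (auto simp: \<tau>_def field_simps power2_eq_square)
  then have d: "Re (\<tau> * d) = - norm d" by simp
  have \<tau>': "cnj \<tau> * \<tau> = 1"
    using complex_norm_square[of \<tau>] \<tau> by (simp add: mult.commute)
  have "(norm s)\<^sup>2 = (norm (\<tau> * c p))\<^sup>2 + (norm (c q))\<^sup>2 + 2 * Re (\<tau> * c p * c q)"
    unfolding s_def norm_minus_cancel cmod_power2 by (simp add: power2_eq_square algebra_simps)
  then have n: "(norm s)\<^sup>2 = (norm (c p))\<^sup>2 + (norm (c q))\<^sup>2 + 2 * Re (\<tau> * c p * c q)"
    using \<tau> by (simp add: norm_mult)
  have "cnj s * \<tau> * c p + s * c q
      = - (cnj \<tau> * \<tau>) * (c p * cnj (c p)) - c q * cnj (c q) - 2 * (\<tau> * c p * c q)"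
    by (simp add: s_def algebra_simps)
  also have "\<dots> = - of_real ((norm (c p))\<^sup>2) - of_real ((norm (c q))\<^sup>2) - 2 * (\<tau> * c p * c q)"
    unfolding \<tau>' complex_norm_square by simp
  finally have "Re (cnj s * \<tau> * c p + s * c q)
      = - (norm (c p))\<^sup>2 - (norm (c q))\<^sup>2 - 2 * Re (\<tau> * c p * c q)" by simp
  moreover have "(norm s)\<^sup>2 + 2 + 2 * (Re (cnj s * \<tau> * c p + s * c q) + Re (\<tau> * c (p + q))) \<ge> 0"
    using moment_quadratic_form_nonneg[OF c \<tau>, of s p q] by simp
  moreover have "Re (\<tau> * c (p + q)) = Re (\<tau> * d) + Re (\<tau> * c p * c q)"
    by (simp add: d_def algebra_simps)
  ultimately have "2 * norm d \<le> 2 - (norm (c p))\<^sup>2 - (norm (c q))\<^sup>2"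
    using n d by argo
  also have "\<dots> \<le> 2 - 2 * (norm (c p) * norm (c q))"
    using zero_le_power2[of "norm (c p) - norm (c q)"] by (simp add: power2_eq_square algebra_simps)
  finally show ?thesis by (simp add: d_def)
qed

lemma exceptional_pair_iff:
  assumes "p \<ge> 1" "q \<ge> 1"
  shows "exceptional_pair (Suc p) (Suc q) \<longleftrightarrow> p * q \<le> p + q + 1"
proof -
  consider "p = 1" | "q = 1" | "p = 2" | "q = 2" | "p \<ge> 3" "q \<ge> 3"
    using assms by linarith
  then show ?thesis
  proof cases
    case 5
    then obtain i j where "p = i + 3" "q = j + 3" by (metis le_add_diff_inverse2)
    then show ?thesis by (simp add: exceptional_pair_def algebra_simps)
  qed (use assms in \<open>auto simp: exceptional_pair_def\<close>)
qed

text \<open>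
  Splitting \<open>(p + 1) * (q + 1)\<close> as \<open>p * q + (p + q + 1)\<close> isolates the covariance and leaves a convex
  combination of \<open>p * q\<close> and \<open>p + q + 1\<close>.
\<close>

lemma moment_positive_zalcman_bound:
  fixes c :: "nat \<Rightarrow> complex"
  assumes c: "moment_positive c" "c 0 = 1" and pq: "p \<ge> 1" "q \<ge> 1"
  shows "norm ((real (Suc p) * c p) * (real (Suc q) * c q) - real (p + q + 1) * c (p + q))
      \<le> (if exceptional_pair (Suc p) (Suc q) then real (p + q + 1) else real p * real q)"
proof -
  define t where "t = norm (c p) * norm (c q)"
  have cov: "norm (c (p + q) - c p * c q) \<le> 1 - t"
    unfolding t_def by (rule moment_covariance_bound[OF c])
  have t: "0 \<le> t" "t \<le> 1"
    using order_trans[OF norm_ge_zero cov] by (simp_all add: t_def)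
  have "(real (Suc p) * c p) * (real (Suc q) * c q) - real (p + q + 1) * c (p + q)
      = of_real (real p * real q) * (c p * c q) - of_real (real (p + q + 1)) * (c (p + q) - c p * c q)"
    by (simp add: algebra_simps)
  also have "norm \<dots> \<le> norm (of_real (real p * real q) * (c p * c q))
      + norm (of_real (real (p + q + 1)) * (c (p + q) - c p * c q))"
    by (rule norm_triangle_ineq4)
  also have "\<dots> = real p * real q * t + real (p + q + 1) * norm (c (p + q) - c p * c q)"
    unfolding norm_mult norm_of_real t_def by simp
  also have "\<dots> \<le> real p * real q * t + real (p + q + 1) * (1 - t)"
    by (intro add_left_mono mult_left_mono cov) simp
  also have "\<dots> \<le> max (real p * real q) (real (p + q + 1))"
    using convex_bound_le[of "real p * real q" "max (real p * real q) (real (p + q + 1))" "real (p + q + 1)" t "1 - t"] t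
    by (simp add: mult.commute)
  also have "\<dots> = (if exceptional_pair (Suc p) (Suc q) then real (p + q + 1) else real p * real q)"
    using exceptional_pair_iff[OF pq] unfolding of_nat_mult[symmetric] of_nat_max[symmetric]
    by (auto simp del: of_nat_add of_nat_mult)
  finally show ?thesis .
qed

lemma closed_convex_hull_class_U_zalcman_bound:
  assumes f: "f \<in> closed_convex_hull class_U" and a: "has_normalized_expansion f a"
    and nm: "n \<ge> 2" "m \<ge> 2"
  shows "norm (a n * a m - a (n + m - 1)) \<le>
      (if exceptional_pair n m then real n + real m - 1 else (real n - 1) * (real m - 1))"
proof -
  define c where "c k = taylor_coeff f (Suc k) / of_nat (Suc k)" for k
  have c: "moment_positive c" "c 0 = 1"
    using closed_convex_hull_class_U_moment_positive(2)[OF f] has_normalized_expansion_taylor_coeff[OF a, of 0]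
    by (simp_all add: c_def[abs_def])
  have ac: "a (Suc k) = real (Suc k) * c k" if "k \<ge> 1" for k
    using has_normalized_expansion_taylor_coeff[OF a, of k] that by (simp add: c_def del: of_nat_Suc)
  define p q where "p = n - 1" and "q = m - 1"
  have eq: "n = Suc p" "m = Suc q" "n + m - 1 = Suc (p + q)" and pq: "p \<ge> 1" "q \<ge> 1"
    using nm by (auto simp: p_def q_def)
  have "a n * a m - a (n + m - 1)
      = (real (Suc p) * c p) * (real (Suc q) * c q) - real (p + q + 1) * c (p + q)"
    unfolding eq(3) unfolding eq(1,2) using pq by (subst ac, simp)+ (simp only: Suc_eq_plus1)
  moreover have "(if exceptional_pair n m then real n + real m - 1 else (real n - 1) * (real m - 1))
      = (if exceptional_pair (Suc p) (Suc q) then real (p + q + 1) else real p * real q)"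
    by (simp add: eq(1,2))
  ultimately show ?thesis
    using moment_positive_zalcman_bound[OF c pq] by (simp only:)
qed

section \<open>Rotations of the Koebe function\<close>

text \<open>
  The expression that defines the class equals \<open>(1 + x z) * (1 - x z) - 1 = - (x z)\<^sup>2\<close>.
\<close>

lemma koebe_rotation_in_class_U:
  assumes x: "norm x = 1"
  shows "koebe_rotation x \<in> class_U"
proof -
  have small: "norm (x * z) < 1" if "z \<in> unit_disk" for z
    using that x by (simp add: norm_mult)
  have nz: "1 - x * z \<noteq> 0" if "z \<in> unit_disk" for z
    using small[OF that] by (metis eq_iff_diff_eq_0 less_irrefl norm_one)
  have der: "(koebe_rotation x has_field_derivative (1 + x * z) / (1 - x * z) ^ 3) (at z)"
    if "z \<in> unit_disk" for z
  proof -
    have "(koebe_rotation x has_field_derivative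
        (1 * (1 - x * z)\<^sup>2 - z * (2 * (1 - x * z) * (- x))) / ((1 - x * z)\<^sup>2 * (1 - x * z)\<^sup>2)) (at z)"
      unfolding koebe_rotation_def[abs_def]
      by (rule derivative_eq_intros refl | use nz[OF that] in simp)+
    moreover have "(1 - x * z)\<^sup>2 - z * (2 * (1 - x * z) * (- x)) = (1 + x * z) * (1 - x * z)"
      by (simp add: power2_eq_square algebra_simps)
    moreover have "(1 + x * z) * v / (v\<^sup>2 * v\<^sup>2) = (1 + x * z) / v ^ 3" if "v \<noteq> 0" for v
      using that by (simp add: power2_eq_square power3_eq_cube)
    ultimately show ?thesis
      using nz[OF that] by simp
  qed
  have deriv: "deriv (koebe_rotation x) z = (1 + x * z) / (1 - x * z) ^ 3" if "z \<in> unit_disk" for z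
    using der[OF that] by (rule DERIV_imp_deriv)
  have hol: "koebe_rotation x holomorphic_on unit_disk"
    unfolding holomorphic_on_open[OF open_ball] using der by blast
  have "norm (deriv (koebe_rotation x) z * (if z = 0 then 1 else z / koebe_rotation x z)\<^sup>2 - 1) < 1"
    if z: "z \<in> unit_disk" for z
  proof -
    have "(if z = 0 then 1 else z / koebe_rotation x z) = (1 - x * z)\<^sup>2"
      using nz[OF z] by (simp add: koebe_rotation_def)
    moreover have "(1 + x * z) / v ^ 3 * (v\<^sup>2)\<^sup>2 = (1 + x * z) * v" if "v \<noteq> 0" for v
      using that by (simp add: power2_eq_square power3_eq_cube)
    ultimately have "deriv (koebe_rotation x) z * (if z = 0 then 1 else z / koebe_rotation x z)\<^sup>2
        = (1 + x * z) * (1 - x * z)"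
      using nz[OF z] deriv[OF z] by (simp only:)
    then have "norm (deriv (koebe_rotation x) z * (if z = 0 then 1 else z / koebe_rotation x z)\<^sup>2 - 1)
        = norm (- (x * z)\<^sup>2)"
      by (simp only:) (simp add: power2_eq_square algebra_simps)
    also have "\<dots> = (norm (x * z))\<^sup>2"
      by (simp only: norm_minus_cancel norm_power)
    also have "\<dots> < 1" using small[OF z] by (simp add: power_less_one_iff)
    finally show ?thesis .
  qed
  then show ?thesis
    using hol nz deriv[of 0] by (auto simp: class_U_def class_A_def hol_disk_def koebe_rotation_def)
qed

lemma koebe_rotation_expansion:
  assumes x: "norm x = 1"
  shows "has_normalized_expansion (koebe_rotation x) (\<lambda>n. of_nat n * x ^ (n - 1))"
  unfolding has_normalized_expansion_def
proof
  fix z :: complex assume "z \<in> unit_disk"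
  then have "norm (x * z) < 1" using x by (simp add: norm_mult)
  from sums_mult[OF geometric_deriv_sums[OF this], of z]
  have "(\<lambda>n. of_nat (Suc n) * x ^ n * z ^ Suc n) sums koebe_rotation x z"
    by (simp add: koebe_rotation_def power_mult_distrib mult_ac del: of_nat_Suc)
  from sums_split_initial_segment[OF this, of 1]
  show "(\<lambda>k. of_nat (k + 2) * x ^ (k + 2 - 1) * z ^ (k + 2)) sums (koebe_rotation x z - z)"
    by simp
qed

theorem theorem4p2:
  shows "(\<forall>f a. f \<in> closed_convex_hull class_U \<longrightarrow> has_normalized_expansion f a \<longrightarrow>
            (\<forall>n\<ge>2. \<forall>m\<ge>2.
               norm (a n * a m - a (n + m - 1)) \<le>
                 (if exceptional_pair n m then real n + real m - 1
                  else (real n - 1) * (real m - 1))))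
       \<and> (\<forall>x::complex. norm x = 1 \<longrightarrow>
            koebe_rotation x \<in> closed_convex_hull class_U \<and>
            (\<exists>a. has_normalized_expansion (koebe_rotation x) a \<and>
               (\<forall>n\<ge>2. \<forall>m\<ge>2. \<not> exceptional_pair n m \<longrightarrow>
                  norm (a n * a m - a (n + m - 1)) = (real n - 1) * (real m - 1))))"
proof (intro conjI allI impI)
  show "norm (a n * a m - a (n + m - 1)) \<le>
      (if exceptional_pair n m then real n + real m - 1 else (real n - 1) * (real m - 1))"
    if "f \<in> closed_convex_hull class_U" "has_normalized_expansion f a" "n \<ge> 2" "m \<ge> 2" for f a n m
    using that by (rule closed_convex_hull_class_U_zalcman_bound)
next
  fix x :: complex assume x: "norm x = 1"
  show "koebe_rotation x \<in> closed_convex_hull class_U"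
    unfolding closed_convex_hull_def by (intro hull_inc koebe_rotation_in_class_U x)
  define a where "a n = of_nat n * x ^ (n - 1)" for n :: nat
  have "norm (a n * a m - a (n + m - 1)) = (real n - 1) * (real m - 1)" if "n \<ge> 2" "m \<ge> 2" for n m
  proof -
    define p q where "p = n - 1" and "q = m - 1"
    have eq: "n = Suc p" "m = Suc q" using that by (auto simp: p_def q_def)
    have "a n * a m - a (n + m - 1) = of_real (real p * real q) * x ^ (p + q)"
      by (simp add: a_def eq power_add algebra_simps)
    then show ?thesis by (simp add: norm_mult norm_power x eq)
  qed
  then show "\<exists>a. has_normalized_expansion (koebe_rotation x) a \<and>
      (\<forall>n\<ge>2. \<forall>m\<ge>2. \<not> exceptional_pair n m \<longrightarrow>
         norm (a n * a m - a (n + m - 1)) = (real n - 1) * (real m - 1))"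
    using koebe_rotation_expansion[OF x] unfolding a_def by blast
qed

end
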